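(* Let $y\in\mathbb{R}^3$, let $v\in T_y\mathbb{R}^3$, let $x\in\mathbb{R}^3\setminus\{y\}$ and $u\in T_x\mathbb{R}^3$, and let $T$ be a Möbius transformation of $\mathbb{R}^3\cup\{\infty\}$ with $T(x)\neq\infty$ and $T(y)\neq\infty$. Then the $1$-form $\widetilde\omega$ is conformally invariant in the sense that $$\widetilde\omega(T(y);T_{*}v)(T_{*}u)=\widetilde\omega(y;v)(u),$$ where $T_*v\in T_{T(y)}\mathbb{R}^3$ and $T_*u\in T_{T(x)}\mathbb{R}^3$ are the images of $v$ and $u$ under the differential of $T$.
   Context: For $y\in\mathbb{R}^3$, $v\in T_y\mathbb{R}^3\cong\mathbb{R}^3$ and $x\in\mathbb{R}^3\setminus\{y\}$, the vector $v$ conformally transported to $x$ is $$\tilde v(x)=\frac{1}{|x-y|^2}\left\{2\left(v\cdot\frac{x-y}{|x-y|}\right)\frac{x-y}{|x-y|}-v\right\}\in T_x\mathbb{R}^3 .$$ The $1$-form $\widetilde\omega(y;v)$ on $\mathbb{R}^3\setminus\{y\}$ is defined by $\widetilde\omega(y;v)(u)=u\cdot\tilde v(x)$ for $x\in\mathbb{R}^3\setminus\{y\}$ and $u\in T_x\mathbb{R}^3$, where $\cdot$ is the Euclidean inner product. Möbius transformations of $\mathbb{R}^3\cup\{\infty\}$ are compositions of inversions in spheres and reflections in planes (orientation-preserving or reversing). *)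

theory Defs
  imports "HOL-Analysis.Analysis"
begin

definition conformal_transport :: "real^3 \<Rightarrow> real^3 \<Rightarrow> real^3 \<Rightarrow> real^3" where
  "conformal_transport y v x =
     (1 / (norm (x - y))\<^sup>2) *\<^sub>R
       ((2 * (v \<bullet> ((x - y) /\<^sub>R norm (x - y)))) *\<^sub>R ((x - y) /\<^sub>R norm (x - y)) - v)"

text \<open>The value at the point \<open>x\<close>, on the tangent vector \<open>u\<close> at \<open>x\<close>, of the 1-form determined
  by the tangent vector \<open>v\<close> at \<open>y\<close>; it is meaningful only for \<open>x \<noteq> y\<close>.\<close>
definition omega_tilde :: "real^3 \<Rightarrow> real^3 \<Rightarrow> real^3 \<Rightarrow> real^3 \<Rightarrow> real" where
  "omega_tilde y v x u = u \<bullet> conformal_transport y v x"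

text \<open>The extended space is represented by the option type, with \<open>None\<close> as the point at
  infinity.\<close>
type_synonym extended_space = "(real^3) option"

definition sphere_inversion :: "real^3 \<Rightarrow> real \<Rightarrow> extended_space \<Rightarrow> extended_space" where
  "sphere_inversion c r p =
     (case p of
        None \<Rightarrow> Some c
      | Some z \<Rightarrow> if z = c then None
                  else Some (c + (r\<^sup>2 / (norm (z - c))\<^sup>2) *\<^sub>R (z - c)))"

text \<open>Reflection in the plane of all \<open>z\<close> with \<open>n \<bullet> z = d\<close>; the normal \<open>n\<close> need not be a unit
  vector.\<close>
definition plane_reflection :: "real^3 \<Rightarrow> real \<Rightarrow> extended_space \<Rightarrow> extended_space" where
  "plane_reflection n d p = map_option (\<lambda>z. z - (2 * (n \<bullet> z - d) / (n \<bullet> n)) *\<^sub>R n) p"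

inductive moebius_transformation :: "(extended_space \<Rightarrow> extended_space) \<Rightarrow> bool" where
  inversion: "r > 0 \<Longrightarrow> moebius_transformation (sphere_inversion c r)"
| reflection: "n \<noteq> 0 \<Longrightarrow> moebius_transformation (plane_reflection n d)"
| compose: "moebius_transformation S \<Longrightarrow> moebius_transformation T \<Longrightarrow> moebius_transformation (S \<circ> T)"

text \<open>The differential at a finite point \<open>p\<close> whose image is finite. A Moebius transformation is
  then finite on a neighbourhood of \<open>p\<close>, so the value of \<open>the None\<close> has no influence.\<close>
definition differential :: "(extended_space \<Rightarrow> extended_space) \<Rightarrow> real^3 \<Rightarrow> real^3 \<Rightarrow> real^3" where
  "differential T p = frechet_derivative (\<lambda>z. the (T (Some z))) (at p)"

end

theory Submission
  imports Defs
begin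

text \<open>Two facts give the invariance.

  First, the form is a mixed second derivative: \<open>omega_tilde y v x u\<close> is the derivative of
  \<open>log |x - y|\<close>, once in \<open>y\<close> along \<open>v\<close> and once in \<open>x\<close> along \<open>u\<close>. Carrying out only the first
  differentiation leaves the rational function \<open>log_dist_gradient\<close>, up to sign.

  Second, a Moebius transformation distorts distances by a factor that splits: there is a
  function \<open>w\<close> with \<open>w x * w y * |T x - T y|\<^sup>2 = |x - y|\<^sup>2\<close> whenever both images are finite.
  Hence \<open>log |T x - T y|\<close> and \<open>log |x - y|\<close> differ by a function of \<open>x\<close> plus a function of
  \<open>y\<close>, and the mixed derivative does not see the difference.

  An induction over compositions in terms of points of space fails for the second fact, because
  an intermediate image of \<open>x\<close> or \<open>y\<close> may be the point at infinity. The light cone model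
  removes this obstacle. A point \<open>z\<close> is represented by the null vector \<open>(z, |z|\<^sup>2, 1)\<close>, and
  infinity by \<open>(0, 1, 0)\<close>, for a Lorentzian bilinear form whose value on the lifts of \<open>x\<close> and
  \<open>y\<close> is \<open>- |x - y|\<^sup>2\<close>. Inversions and plane reflections both become reflections in a
  hyperplane, so each Moebius transformation is induced by a linear isometry of the form
  (\<open>moebius_lorentz_representation\<close>), and linear maps compose without exceptional points. The
  last coordinate of the image vector is the factor \<open>w\<close>, and \<open>T\<close> is differentiable because it is
  the quotient of the first coordinate by \<open>w\<close>.\<close>

section \<open>The light cone model\<close>

type_synonym lorentz_space = "(real^3) \<times> real \<times> real"

definition lorentz_form :: "lorentz_space \<Rightarrow> lorentz_space \<Rightarrow> real" where
  "lorentz_form X Y = 2 * (fst X \<bullet> fst Y) - fst (snd X) * snd (snd Y) - snd (snd X) * fst (snd Y)"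

definition null_lift :: "extended_space \<Rightarrow> lorentz_space" where
  "null_lift p = (case p of None \<Rightarrow> (0, 1, 0) | Some z \<Rightarrow> (z, (norm z)\<^sup>2, 1))"

definition lorentz_reflection :: "lorentz_space \<Rightarrow> lorentz_space \<Rightarrow> lorentz_space" where
  "lorentz_reflection N X = X - (2 * lorentz_form X N / lorentz_form N N) *\<^sub>R N"

definition lorentz_isometry :: "(lorentz_space \<Rightarrow> lorentz_space) \<Rightarrow> bool" where
  "lorentz_isometry P \<longleftrightarrow> linear P \<and> (\<forall>X Y. lorentz_form (P X) (P Y) = lorentz_form X Y)"

text \<open>A point corresponds to the line spanned by its lift, not to one vector; the lift of the
  image point is therefore reached only up to a factor, which depends on the point.\<close>
definition represents :: "(lorentz_space \<Rightarrow> lorentz_space) \<Rightarrow> (extended_space \<Rightarrow> extended_space) \<Rightarrow> bool" where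
  "represents P T \<longleftrightarrow> (\<forall>p. \<exists>k. k \<noteq> 0 \<and> P (null_lift p) = k *\<^sub>R null_lift (T p))"

lemma lorentz_form_simps:
  "lorentz_form (X + Y) Z = lorentz_form X Z + lorentz_form Y Z"
  "lorentz_form (X - Y) Z = lorentz_form X Z - lorentz_form Y Z"
  "lorentz_form (k *\<^sub>R X) Z = k * lorentz_form X Z"
  "lorentz_form Z (X + Y) = lorentz_form Z X + lorentz_form Z Y"
  "lorentz_form Z (X - Y) = lorentz_form Z X - lorentz_form Z Y"
  "lorentz_form Z (k *\<^sub>R X) = k * lorentz_form Z X"
  by (simp_all add: lorentz_form_def algebra_simps inner_add_left inner_add_right
      inner_diff_left inner_diff_right)

lemma lorentz_form_commute: "lorentz_form X Y = lorentz_form Y X"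
  by (simp add: lorentz_form_def inner_commute)

lemma lorentz_form_null_lift:
  "lorentz_form (null_lift (Some x)) (null_lift (Some y)) = - (norm (x - y))\<^sup>2"
  by (simp add: lorentz_form_def null_lift_def power2_norm_eq_inner inner_diff_left
      inner_diff_right inner_commute)

lemma lorentz_form_null_lift_self: "lorentz_form (null_lift p) (null_lift p) = 0"
  by (cases p) (simp_all add: lorentz_form_def null_lift_def power2_norm_eq_inner)

text \<open>On the light cone the middle coordinate is determined by the other two. Therefore only the
  first and the last coordinate of an image vector have to be computed.\<close>
lemma null_vector_eq_lift:
  assumes "lorentz_form Y Y = 0" "snd (snd Y) \<noteq> 0"
  shows "Y = snd (snd Y) *\<^sub>R null_lift (Some (fst Y /\<^sub>R snd (snd Y)))"
proof -
  obtain a h w where Y: "Y = (a, h, w)"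
    by (cases Y)
  have "a \<bullet> a = h * w"
    using assms(1) by (simp add: Y lorentz_form_def)
  then have "h = w * ((a /\<^sub>R w) \<bullet> (a /\<^sub>R w))"
    using assms(2) by (simp add: Y field_simps)
  then show ?thesis
    using assms(2) by (simp add: Y null_lift_def power2_norm_eq_inner del: norm_scaleR)
qed

lemma lorentz_isometry_form:
  "lorentz_isometry P \<Longrightarrow> lorentz_form (P X) (P Y) = lorentz_form X Y"
  unfolding lorentz_isometry_def by blast

lemma lorentz_isometry_reflection:
  assumes "lorentz_form N N \<noteq> 0"
  shows "lorentz_isometry (lorentz_reflection N)"
  unfolding lorentz_isometry_def
proof (intro conjI allI)
  show "linear (lorentz_reflection N)"
    by (rule linearI)
      (simp_all add: lorentz_reflection_def lorentz_form_simps algebra_simps add_divide_distrib)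
  show "lorentz_form (lorentz_reflection N X) (lorentz_reflection N Y) = lorentz_form X Y" for X Y
    using assms lorentz_form_commute[of N Y]
    by (simp add: lorentz_reflection_def lorentz_form_simps field_simps)
qed

text \<open>The plane \<open>n \<bullet> z = d\<close> consists of the points whose lifts are orthogonal to
  \<open>(n, 2 * d, 0)\<close>.\<close>
lemma represents_plane_reflection:
  assumes "n \<noteq> 0"
  shows "represents (lorentz_reflection (n, 2 * d, 0)) (plane_reflection n d)"
  unfolding represents_def
proof
  fix p
  let ?N = "(n, 2 * d, 0) :: lorentz_space"
  let ?Y = "lorentz_reflection ?N (null_lift p)"
  have NN: "lorentz_form ?N ?N = 2 * (n \<bullet> n)"
    by (simp add: lorentz_form_def)
  have null: "lorentz_form ?Y ?Y = 0"
    using lorentz_isometry_form[OF lorentz_isometry_reflection[of ?N]] assms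
    by (simp add: NN lorentz_form_null_lift_self)
  show "\<exists>k. k \<noteq> 0 \<and> ?Y = k *\<^sub>R null_lift (plane_reflection n d p)"
  proof (cases p)
    case None
    then have "?Y = 1 *\<^sub>R null_lift (plane_reflection n d p)"
      by (simp add: lorentz_reflection_def null_lift_def plane_reflection_def lorentz_form_def
        del: scaleR_one)
    then show ?thesis by (intro exI[of _ 1]) simp
  next
    case (Some z)
    have last: "snd (snd ?Y) = 1"
      by (simp add: Some lorentz_reflection_def null_lift_def)
    have XN: "lorentz_form (null_lift p) ?N = 2 * (n \<bullet> z - d)"
      by (simp add: Some null_lift_def lorentz_form_def inner_commute)
    have first: "fst ?Y = z - (2 * (n \<bullet> z - d) / (n \<bullet> n)) *\<^sub>R n"
      unfolding lorentz_reflection_def NN XN using assms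
      by (simp add: Some null_lift_def field_simps)
    show ?thesis
      using null_vector_eq_lift[OF null] last first
      by (intro exI[of _ 1]) (simp add: Some plane_reflection_def)
  qed
qed

text \<open>The sphere with centre \<open>c\<close> and radius \<open>r\<close> consists of the points whose lifts are orthogonal
  to \<open>(c, |c|\<^sup>2 - r\<^sup>2, 1)\<close>, because the form takes the value \<open>r\<^sup>2 - |z - c|\<^sup>2\<close> on this vector and
  the lift of \<open>z\<close>.\<close>
lemma represents_sphere_inversion:
  assumes "r > 0"
  shows "represents (lorentz_reflection (c, (norm c)\<^sup>2 - r\<^sup>2, 1)) (sphere_inversion c r)"
  unfolding represents_def
proof
  fix p
  let ?N = "(c, (norm c)\<^sup>2 - r\<^sup>2, 1) :: lorentz_space"
  let ?Y = "lorentz_reflection ?N (null_lift p)"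
  have NN: "lorentz_form ?N ?N = 2 * r\<^sup>2"
    by (simp add: lorentz_form_def power2_norm_eq_inner)
  have null: "lorentz_form ?Y ?Y = 0"
    using lorentz_isometry_form[OF lorentz_isometry_reflection[of ?N]] assms
    by (simp add: NN lorentz_form_null_lift_self)
  show "\<exists>k. k \<noteq> 0 \<and> ?Y = k *\<^sub>R null_lift (sphere_inversion c r p)"
  proof (cases p)
    case None
    have "?Y = (1 / r\<^sup>2) *\<^sub>R null_lift (sphere_inversion c r p)"
      using assms unfolding lorentz_reflection_def NN
      by (simp add: None null_lift_def sphere_inversion_def lorentz_form_def field_simps)
    then show ?thesis
      using assms by (intro exI[of _ "1 / r\<^sup>2"]) simp
  next
    case (Some z)
    have XN: "lorentz_form (null_lift p) ?N = r\<^sup>2 - (norm (z - c))\<^sup>2"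
      by (simp add: Some null_lift_def lorentz_form_def power2_norm_eq_inner inner_diff_left
          inner_diff_right inner_commute)
    have Y: "?Y = null_lift p - (1 - (norm (z - c))\<^sup>2 / r\<^sup>2) *\<^sub>R ?N"
      using assms unfolding lorentz_reflection_def NN XN by (simp add: field_simps)
    show ?thesis
    proof (cases "z = c")
      case True
      then have "?Y = r\<^sup>2 *\<^sub>R null_lift (sphere_inversion c r p)"
        unfolding Y by (simp add: Some null_lift_def sphere_inversion_def)
      then show ?thesis
        using assms by (intro exI[of _ "r\<^sup>2"]) simp
    next
      case False
      define k where "k = (norm (z - c))\<^sup>2 / r\<^sup>2"
      have k: "k \<noteq> 0"
        using False assms by (simp add: k_def)
      have last: "snd (snd ?Y) = k"
        unfolding Y by (simp add: Some null_lift_def k_def)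
      have "fst ?Y = k *\<^sub>R c + (z - c)"
        unfolding Y by (simp add: Some null_lift_def k_def algebra_simps)
      then have "fst ?Y /\<^sub>R k = c + (r\<^sup>2 / (norm (z - c))\<^sup>2) *\<^sub>R (z - c)"
        using k by (simp add: scaleR_add_right) (simp add: k_def)
      then show ?thesis
        using null_vector_eq_lift[OF null] last k False
        by (intro exI[of _ k]) (simp add: Some sphere_inversion_def)
    qed
  qed
qed

theorem moebius_lorentz_representation:
  assumes "moebius_transformation T"
  shows "\<exists>P. lorentz_isometry P \<and> represents P T"
  using assms
proof induction
  case (inversion r c)
  have "lorentz_form (c, (norm c)\<^sup>2 - r\<^sup>2, 1) (c, (norm c)\<^sup>2 - r\<^sup>2, 1) = 2 * r\<^sup>2"
    by (simp add: lorentz_form_def power2_norm_eq_inner)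
  then show ?case
    using inversion represents_sphere_inversion lorentz_isometry_reflection
    by (metis less_numeral_extra(3) mult_eq_0_iff power_eq_0_iff zero_neq_numeral)
next
  case (reflection n d)
  have "lorentz_form (n, 2 * d, 0) (n, 2 * d, 0) = 2 * (n \<bullet> n)"
    by (simp add: lorentz_form_def)
  then show ?case
    using reflection represents_plane_reflection lorentz_isometry_reflection
    by (metis inner_eq_zero_iff mult_eq_0_iff zero_neq_numeral)
next
  case (compose S T)
  then obtain P Q where P: "lorentz_isometry P" "represents P S"
    and Q: "lorentz_isometry Q" "represents Q T"
    by blast
  have "lorentz_isometry (P \<circ> Q)"
    using P(1) Q(1) unfolding lorentz_isometry_def
    by (simp add: linear_compose del: split_paired_All)
  moreover have "represents (P \<circ> Q) (S \<circ> T)"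
    unfolding represents_def
  proof
    fix p
    obtain k where k: "k \<noteq> 0" "Q (null_lift p) = k *\<^sub>R null_lift (T p)"
      using Q(2) by (auto simp: represents_def)
    obtain l where l: "l \<noteq> 0" "P (null_lift (T p)) = l *\<^sub>R null_lift (S (T p))"
      using P(2) by (auto simp: represents_def)
    have "(P \<circ> Q) (null_lift p) = (k * l) *\<^sub>R null_lift ((S \<circ> T) p)"
      using P(1) k l by (simp add: lorentz_isometry_def linear_scale)
    then show "\<exists>m. m \<noteq> 0 \<and> (P \<circ> Q) (null_lift p) = m *\<^sub>R null_lift ((S \<circ> T) p)"
      using k(1) l(1) by (metis mult_eq_0_iff)
  qed
  ultimately show ?case by blast
qed

section \<open>Distortion of distances and differentiability\<close>

lemma differentiable_eventually_nonzero:
  fixes w :: "'a::real_normed_vector \<Rightarrow> real"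
  assumes "w differentiable at z" "w z \<noteq> 0"
  shows "\<forall>\<^sub>F z' in at z. w z' \<noteq> 0"
  using differentiable_imp_continuous_within[OF assms(1)] assms(2)
  by (intro tendsto_imp_eventually_ne[of w "w z"]) (simp_all add: isContD)

text \<open>The factor \<open>w\<close> is the last coordinate of the image of the lift. It vanishes exactly where
  the image point is infinite, since the lift of infinity is the only one with last coordinate
  zero; elsewhere the image point is a quotient with denominator \<open>w\<close>. The distortion identity is
  the invariance of the form, evaluated on two lifts.\<close>
lemma moebius_conformal_factor:
  assumes "moebius_transformation T"
  obtains w :: "real^3 \<Rightarrow> real"
  where "\<And>z. w differentiable at z"
    and "\<And>z. T (Some z) \<noteq> None \<longleftrightarrow> w z \<noteq> 0"
    and "\<And>z. w z \<noteq> 0 \<Longrightarrow> (\<lambda>z. the (T (Some z))) differentiable at z"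
    and "\<And>z z'. w z \<noteq> 0 \<Longrightarrow> w z' \<noteq> 0 \<Longrightarrow>
      w z * w z' * (norm (the (T (Some z)) - the (T (Some z'))))\<^sup>2 = (norm (z - z'))\<^sup>2"
proof -
  obtain P where lin: "linear P"
    and iso: "\<And>X Y. lorentz_form (P X) (P Y) = lorentz_form X Y"
    and rep: "represents P T"
    using moebius_lorentz_representation[OF assms] unfolding lorentz_isometry_def by blast
  define image where "image z = P (null_lift (Some z))" for z
  define w where "w z = snd (snd (image z))" for z
  define f where "f z = the (T (Some z))" for z
  have image_cases: "image z = w z *\<^sub>R null_lift (Some (f z)) \<and> T (Some z) \<noteq> None \<and> w z \<noteq> 0
      \<or> T (Some z) = None \<and> w z = 0" for z
  proof -
    obtain k where k: "k \<noteq> 0" "image z = k *\<^sub>R null_lift (T (Some z))"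
      using rep by (auto simp: represents_def image_def)
    then show ?thesis
      by (cases "T (Some z)") (auto simp: w_def f_def null_lift_def)
  qed
  have lift': "((\<lambda>z. null_lift (Some z)) has_derivative (\<lambda>h. (h, 2 * (z \<bullet> h), 0))) (at z)" for z
    unfolding null_lift_def power2_norm_eq_inner option.case
    by (auto intro!: derivative_eq_intros simp: inner_commute)
  have image': "(image has_derivative (\<lambda>h. P (h, 2 * (z \<bullet> h), 0))) (at z)" for z
    unfolding image_def
    by (rule bounded_linear.has_derivative[OF linear_conv_bounded_linear[THEN iffD1, OF lin] lift'])
  have w': "(w has_derivative (\<lambda>h. snd (snd (P (h, 2 * (z \<bullet> h), 0))))) (at z)" for z
    unfolding w_def by (intro has_derivative_snd image')
  have w_diff: "w differentiable at z" for z
    using w' differentiable_def by blast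
  have "f differentiable at z" if nz: "w z \<noteq> 0" for z
  proof -
    obtain d where d: "((\<lambda>z. fst (image z) /\<^sub>R w z) has_derivative d) (at z)"
      using Deriv.has_derivative_scaleR[OF Deriv.has_derivative_inverse[OF nz w']
          has_derivative_fst[OF image']] by blast
    have quotient: "fst (image z') /\<^sub>R w z' = f z'" if "w z' \<noteq> 0" for z'
      using image_cases[of z'] that by (auto simp: null_lift_def)
    have "\<forall>\<^sub>F z' in at z. fst (image z') /\<^sub>R w z' = f z'"
      using differentiable_eventually_nonzero[OF w_diff nz] by eventually_elim (rule quotient)
    from has_derivative_transform_eventually[OF d this quotient[OF nz]] show ?thesis
      unfolding differentiable_def by blast
  qed
  moreover have "w z * w z' * (norm (f z - f z'))\<^sup>2 = (norm (z - z'))\<^sup>2"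
    if "w z \<noteq> 0" "w z' \<noteq> 0" for z z'
  proof -
    have "- (norm (z - z'))\<^sup>2 = lorentz_form (image z) (image z')"
      by (simp add: image_def iso lorentz_form_null_lift)
    also have "\<dots> = lorentz_form (w z *\<^sub>R null_lift (Some (f z))) (w z' *\<^sub>R null_lift (Some (f z')))"
      using image_cases[of z] image_cases[of z'] that by auto
    also have "\<dots> = - (w z * w z' * (norm (f z - f z'))\<^sup>2)"
      by (simp add: lorentz_form_simps lorentz_form_null_lift)
    finally show ?thesis by simp
  qed
  moreover have "T (Some z) \<noteq> None \<longleftrightarrow> w z \<noteq> 0" for z
    using image_cases[of z] by auto
  ultimately show thesis
    using that[of w] w_diff unfolding f_def by blast
qed

section \<open>The form as a mixed derivative\<close>

text \<open>The derivative of \<open>log |x - y|\<close> in \<open>x\<close> along \<open>v\<close>, which is also minus its derivative in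
  \<open>y\<close> along \<open>v\<close>.\<close>
definition log_dist_gradient :: "real^3 \<Rightarrow> real^3 \<Rightarrow> real^3 \<Rightarrow> real" where
  "log_dist_gradient y v x = ((x - y) \<bullet> v) / (norm (x - y))\<^sup>2"

lemma omega_tilde_expand:
  assumes "x \<noteq> y"
  shows "omega_tilde y v x u =
    2 * ((x - y) \<bullet> v) * ((x - y) \<bullet> u) / (norm (x - y))^4 - (u \<bullet> v) / (norm (x - y))\<^sup>2"
proof -
  define e where "e = x - y"
  have "norm e \<noteq> 0"
    using assms by (simp add: e_def)
  then show ?thesis
    unfolding omega_tilde_def conformal_transport_def e_def[symmetric]
    by (simp add: inner_diff_right inner_commute field_simps power2_eq_square power4_eq_xxxx)
qed

lemma has_derivative_log_dist_gradient:
  assumes "x \<noteq> y"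
  shows "(log_dist_gradient y v has_derivative (\<lambda>u. - omega_tilde y v x u)) (at x)"
proof -
  have e: "(x - y) \<bullet> (x - y) \<noteq> 0"
    using assms by simp
  have four: "norm (x - y) ^ 4 = ((x - y) \<bullet> (x - y))\<^sup>2"
    by (metis power2_norm_eq_inner power_mult num_double numeral_times_numeral mult_2_right)
  show ?thesis
    unfolding log_dist_gradient_def[abs_def] omega_tilde_expand[OF assms] four power2_norm_eq_inner
    by (rule derivative_eq_intros refl e)+
      (use e in \<open>auto simp: fun_eq_iff field_simps power2_eq_square inner_commute\<close>)
qed

text \<open>Differentiating the distortion identity in \<open>y\<close> along \<open>v\<close>, and dividing by it, shows that
  the logarithmic gradient changes only by a summand that does not depend on \<open>z\<close>; the summand is
  half the logarithmic derivative of the factor at \<open>y\<close> along \<open>v\<close>.\<close>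
lemma log_dist_gradient_distortion:
  fixes f :: "real^3 \<Rightarrow> real^3" and w :: "real^3 \<Rightarrow> real"
  assumes distortion: "\<And>z z'. w z \<noteq> 0 \<Longrightarrow> w z' \<noteq> 0 \<Longrightarrow>
      w z * w z' * (norm (f z - f z'))\<^sup>2 = (norm (z - z'))\<^sup>2"
    and w': "(w has_derivative w') (at y)" and f': "(f has_derivative f') (at y)"
    and "w y \<noteq> 0" "w z \<noteq> 0" "z \<noteq> y"
  shows "log_dist_gradient (f y) (f' v) (f z) = log_dist_gradient y v z + w' v / (2 * w y)"
proof -
  define F where "F = f z - f y"
  have base: "w z * w y * (F \<bullet> F) = (z - y) \<bullet> (z - y)"
    using distortion[of z y] assms by (simp add: F_def power2_norm_eq_inner)
  have lhs: "((\<lambda>y'. w z * w y' * ((f z - f y') \<bullet> (f z - f y'))) has_derivative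
      (\<lambda>h. w z * w' h * (F \<bullet> F) - 2 * w z * w y * (F \<bullet> f' h))) (at y)"
    unfolding F_def
    by (rule derivative_eq_intros w' f' refl)+
      (auto simp: fun_eq_iff algebra_simps inner_commute)
  have rhs: "((\<lambda>y'. (z - y') \<bullet> (z - y')) has_derivative (\<lambda>h. - 2 * ((z - y) \<bullet> h))) (at y)"
    by (rule derivative_eq_intros refl)+ (auto simp: fun_eq_iff algebra_simps inner_commute)
  have "\<forall>\<^sub>F y' in at y. w y' \<noteq> 0"
    using w' \<open>w y \<noteq> 0\<close> by (intro differentiable_eventually_nonzero differentiableI)
  then have ev: "\<forall>\<^sub>F y' in at y. w z * w y' * ((f z - f y') \<bullet> (f z - f y')) = (z - y') \<bullet> (z - y')"
  proof eventually_elim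
    case (elim y')
    then show ?case
      using distortion[of z y'] assms by (simp add: power2_norm_eq_inner)
  qed
  have "((\<lambda>y'. (z - y') \<bullet> (z - y')) has_derivative
      (\<lambda>h. w z * w' h * (F \<bullet> F) - 2 * w z * w y * (F \<bullet> f' h))) (at y)"
    by (rule has_derivative_transform_eventually[OF lhs ev]) (use base in \<open>auto simp: F_def\<close>)
  from fun_cong[OF has_derivative_unique[OF this rhs], of v]
  have deriv: "w z * w' v * (F \<bullet> F) - 2 * w z * w y * (F \<bullet> f' v) = - 2 * ((z - y) \<bullet> v)" .
  have "F \<bullet> F \<noteq> 0"
    using base \<open>z \<noteq> y\<close> by auto
  have "log_dist_gradient y v z = ((z - y) \<bullet> v) / (w z * w y * (F \<bullet> F))"
    by (simp only: log_dist_gradient_def power2_norm_eq_inner base)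
  also have "(z - y) \<bullet> v = w z * w y * (F \<bullet> f' v) - w z * w' v * (F \<bullet> F) / 2"
    using deriv by simp
  also have "(w z * w y * (F \<bullet> f' v) - w z * w' v * (F \<bullet> F) / 2) / (w z * w y * (F \<bullet> F))
      = (F \<bullet> f' v) / (F \<bullet> F) - w' v / (2 * w y)"
    using \<open>F \<bullet> F \<noteq> 0\<close> \<open>w y \<noteq> 0\<close> \<open>w z \<noteq> 0\<close> by (simp add: field_simps)
  finally show ?thesis
    by (simp add: log_dist_gradient_def power2_norm_eq_inner F_def)
qed

theorem proposition4p5:
  fixes x y u v :: "real^3" and T :: "extended_space \<Rightarrow> extended_space"
  assumes "x \<noteq> y"
    and "moebius_transformation T"
    and "T (Some x) \<noteq> None" and "T (Some y) \<noteq> None"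
  shows "omega_tilde (the (T (Some y))) (differential T y v)
           (the (T (Some x))) (differential T x u) = omega_tilde y v x u"
proof -
  define f where "f z = the (T (Some z))" for z
  obtain w where w_diff: "\<And>z. w differentiable at z"
    and finite: "\<And>z. T (Some z) \<noteq> None \<longleftrightarrow> w z \<noteq> 0"
    and f_diff: "\<And>z. w z \<noteq> 0 \<Longrightarrow> f differentiable at z"
    and distortion: "\<And>z z'. w z \<noteq> 0 \<Longrightarrow> w z' \<noteq> 0 \<Longrightarrow>
      w z * w z' * (norm (f z - f z'))\<^sup>2 = (norm (z - z'))\<^sup>2"
    using moebius_conformal_factor[OF assms(2)] unfolding f_def by blast
  have wx: "w x \<noteq> 0" and wy: "w y \<noteq> 0"
    using assms finite by auto
  have f': "(f has_derivative differential T z) (at z)" if "w z \<noteq> 0" for z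
    using f_diff[OF that] frechet_derivative_works unfolding differential_def f_def by blast
  obtain w' where w': "(w has_derivative w') (at y)"
    using w_diff differentiable_def by blast
  have "f x \<noteq> f y"
    using distortion[OF wx wy] \<open>x \<noteq> y\<close> by auto
  let ?v = "differential T y v"
  \<comment> \<open>Near \<open>x\<close> the two logarithmic gradients differ by a constant, as functions of the
    point; differentiating them along \<open>u\<close> removes the constant and yields minus the two forms.\<close>
  have lhs: "((\<lambda>z. log_dist_gradient (f y) ?v (f z)) has_derivative
      (\<lambda>h. - omega_tilde (f y) ?v (f x) (differential T x h))) (at x)"
    using has_derivative_compose[OF f'[OF wx] has_derivative_log_dist_gradient[OF \<open>f x \<noteq> f y\<close>]] .
  have rhs: "((\<lambda>z. log_dist_gradient y v z + w' v / (2 * w y)) has_derivative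
      (\<lambda>h. - omega_tilde y v x h)) (at x)"
    using has_derivative_add[OF has_derivative_log_dist_gradient[OF \<open>x \<noteq> y\<close>] has_derivative_const]
    by simp
  have eq: "log_dist_gradient (f y) ?v (f z) = log_dist_gradient y v z + w' v / (2 * w y)"
    if "w z \<noteq> 0" "z \<noteq> y" for z
    using log_dist_gradient_distortion[OF distortion w' f'[OF wy] wy that] .
  have "\<forall>\<^sub>F z in at x. w z \<noteq> 0"
    by (rule differentiable_eventually_nonzero[OF w_diff wx])
  moreover have "\<forall>\<^sub>F z in at x. z \<noteq> y"
    using \<open>x \<noteq> y\<close> by (intro tendsto_imp_eventually_ne[OF tendsto_ident_at])
  ultimately have ev: "\<forall>\<^sub>F z in at x.
      log_dist_gradient (f y) ?v (f z) = log_dist_gradient y v z + w' v / (2 * w y)"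
    by eventually_elim (rule eq)
  have "((\<lambda>z. log_dist_gradient y v z + w' v / (2 * w y)) has_derivative
      (\<lambda>h. - omega_tilde (f y) ?v (f x) (differential T x h))) (at x)"
    by (rule has_derivative_transform_eventually[OF lhs ev]) (use eq wx \<open>x \<noteq> y\<close> in auto)
  from fun_cong[OF has_derivative_unique[OF this rhs], of u] show ?thesis
    by (simp add: f_def)
qed

end
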